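(* Let the function $f$ have a sufficient number of continuous derivatives in a neighborhood of $\alpha$, where $\alpha$ is a simple root of $f$. Consider the iterative method $$y_n=x_n-a\,\frac{f(x_n)}{f'(x_n)},\qquad x_{n+1}=x_n-\frac12\left[3-\frac{f'(y_n)}{f'(x_n)}\right]\frac{f(x_n)}{f'(x_n)}\times G(t),\qquad t=\frac{f'(y_n)}{f'(x_n)},$$ where $G$ is a real-valued weight function and $a$ is a real constant. This method has fourth-order convergence when $a=2/3$ and the weight function $G$ satisfies the conditions $$G(1)=1,\qquad G'(1)=-\frac14,\qquad G''(1)=2,\qquad \left|G^{(3)}(1)\right|<+\infty,$$ and the error equation is given by $$e_{n+1}=\left[-c_2c_3+\frac{c_4}{9}+\frac{1}{81}\left\{309+32\,G^{(3)}(1)\right\}c_2^3\right]e_n^4+O(e_n^5),$$ where $e_n=x_n-\alpha$ and $c_h=\dfrac{f^{(h)}(\alpha)}{h!\,f'(\alpha)}$ for $h=2,3,4$.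
   Context: Here $f$ is a real function of a real variable, and a simple root $\alpha$ of $f$ is a point with $f(\alpha)=0$ and $f'(\alpha)\neq 0$. Order of convergence is defined as follows: if $f$ is a real function with a simple root $\alpha$ and $(x_n)$ is a sequence of real numbers that converges towards $\alpha$, the order of convergence $m\in\mathbb{R}^+$ is given by $$\lim_{n\to\infty}\frac{x_{n+1}-\alpha}{(x_n-\alpha)^m}=\zeta\neq 0,$$ where $\zeta$ is the asymptotic error constant. Fourth-order convergence means $m=4$.
   Formalization: The remainder O(e_n^5) is claimed when G has four continuous derivatives near 1 (under the stated conditions alone it can fail, and o(e_n^4) is proved); order four is claimed when the bracket in the error equation is nonzero and no x_n equals α. *)

theory Defs
  imports "HOL-Analysis.Analysis" "HOL-Library.Landau_Symbols"
begin

definition continuously_differentiable_near :: "nat \<Rightarrow> (real \<Rightarrow> real) \<Rightarrow> real \<Rightarrow> bool" where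
  "continuously_differentiable_near k f p \<longleftrightarrow>
     (\<exists>S. open S \<and> p \<in> S \<and>
        (\<forall>j<k. \<forall>x\<in>S. (deriv ^^ j) f differentiable (at x)) \<and>
        continuous_on S ((deriv ^^ k) f))"

text \<open>The \<open>k\<close>-th derivative exists at the point \<open>p\<close> itself. Since \<open>deriv\<close> is
  total, the derivatives of order below \<open>k\<close> must be required to exist in a neighbourhood of \<open>p\<close>.\<close>

definition times_differentiable_at :: "nat \<Rightarrow> (real \<Rightarrow> real) \<Rightarrow> real \<Rightarrow> bool" where
  "times_differentiable_at k g p \<longleftrightarrow>
     (\<forall>j. Suc j < k \<longrightarrow> (\<forall>\<^sub>F x in nhds p. (deriv ^^ j) g differentiable (at x))) \<and>
     (\<forall>j<k. (deriv ^^ j) g differentiable (at p))"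

definition simple_root :: "(real \<Rightarrow> real) \<Rightarrow> real \<Rightarrow> bool" where
  "simple_root f \<alpha> \<longleftrightarrow> f \<alpha> = 0 \<and> deriv f \<alpha> \<noteq> 0"

text \<open>The order \<open>m\<close> is a natural number, so that \<open>(x n - \<alpha>) ^ m\<close> is meaningful for
  errors of either sign. If \<open>x\<close> reaches \<open>\<alpha>\<close>, the quotient is undefined in the usual
  reading; hence \<open>x n \<noteq> \<alpha>\<close> is part of the definition.\<close>

definition has_convergence_order :: "(nat \<Rightarrow> real) \<Rightarrow> real \<Rightarrow> nat \<Rightarrow> real \<Rightarrow> bool" where
  "has_convergence_order x \<alpha> m \<zeta> \<longleftrightarrow>
     0 < m \<and> x \<longlonglongrightarrow> \<alpha> \<and> (\<forall>n. x n \<noteq> \<alpha>) \<and> \<zeta> \<noteq> 0 \<and>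
     (\<lambda>n. (x (Suc n) - \<alpha>) / (x n - \<alpha>) ^ m) \<longlonglongrightarrow> \<zeta>"

definition method_step :: "(real \<Rightarrow> real) \<Rightarrow> (real \<Rightarrow> real) \<Rightarrow> real \<Rightarrow> real \<Rightarrow> real" where
  "method_step f G a x =
     (let y = x - a * (f x / deriv f x);
          t = deriv f y / deriv f x
      in x - 1/2 * (3 - t) * (f x / deriv f x) * G t)"

definition method_sequence ::
    "(real \<Rightarrow> real) \<Rightarrow> (real \<Rightarrow> real) \<Rightarrow> real \<Rightarrow> (nat \<Rightarrow> real) \<Rightarrow> bool" where
  "method_sequence f G a x \<longleftrightarrow> (\<forall>n. x (Suc n) = method_step f G a (x n))"

definition error_coeff :: "(real \<Rightarrow> real) \<Rightarrow> real \<Rightarrow> nat \<Rightarrow> real" where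
  "error_coeff f \<alpha> h = (deriv ^^ h) f \<alpha> / (fact h * deriv f \<alpha>)"

end

theory Submission
  imports Defs
begin

text \<open>Put \<open>e = x - \<alpha>\<close> and write \<open>f (\<alpha> + e) = e * \<phi> e\<close>, so that \<open>f / f' = e * v e\<close> with
  \<open>v = \<phi> / f'\<close>. Then \<open>v\<close>, \<open>t\<close> and \<open>G t\<close> are needed only up to \<open>O(e ^ 4)\<close>, because the new error is
  \<open>e * (1 - (3 - t) * v * G t / 2)\<close>, and the conditions on \<open>G\<close> make the first three coefficients of
  the bracket vanish. As \<open>t - 1 = O(e)\<close>, the Taylor remainder of \<open>G\<close> at \<open>1\<close> only contributes
  \<open>o(e ^ 4)\<close>, and \<open>O(e ^ 5)\<close> if \<open>G\<close> has one more derivative. All estimates use the filter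
  \<open>nhds 0\<close> rather than \<open>at 0\<close>, so they also cover sequences that hit the root.\<close>

section \<open>Landau estimates on full neighbourhoods, centre included\<close>

lemma isCont_imp_bigo_1:
  fixes h :: "real \<Rightarrow> real"
  assumes "isCont h p"
  shows "h \<in> O[nhds p](\<lambda>_. 1)"
proof -
  have "((\<lambda>x. h x / 1) \<longlongrightarrow> h p) (nhds p)"
    using assms by (simp add: isCont_def tendsto_at_iff_tendsto_nhds)
  then show ?thesis by (rule bigoI_tendsto) simp
qed

lemma bigo_nhds_0_power_mono:
  assumes "n \<le> m"
  shows "(\<lambda>e::real. e ^ m) \<in> O[nhds 0](\<lambda>e. e ^ n)"
proof -
  have "(\<lambda>e::real. e ^ n * e ^ (m - n)) \<in> O[nhds 0](\<lambda>e. e ^ n * 1)"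
    by (intro landau_o.big.mult isCont_imp_bigo_1 landau_o.big_refl) simp
  with assms show ?thesis by (simp flip: power_add)
qed

lemma bigo_id_imp_tendsto_0:
  fixes F :: "real \<Rightarrow> real"
  assumes "F \<in> O[nhds 0](\<lambda>e. e)"
  shows "(F \<longlongrightarrow> 0) (nhds 0)"
proof -
  obtain c where c: "\<forall>\<^sub>F e in nhds 0. norm (F e) \<le> c * norm e"
    using assms by (auto elim: landau_o.bigE)
  have "((\<lambda>e::real. c * norm e) \<longlongrightarrow> c * norm (0::real)) (nhds 0)"
    by (intro tendsto_intros filterlim_ident)
  then have "((\<lambda>e::real. c * norm e) \<longlongrightarrow> 0) (nhds 0)" by simp
  with c show ?thesis by (rule Lim_null_comparison)
qed

text \<open>Mean value inequality: on the ball of radius \<open>\<bar>e\<bar>\<close> the derivative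
  is at most \<open>c * \<bar>e\<bar> ^ k\<close>, and the distance to 0 supplies the additional
  factor. This is the induction step for the Taylor remainder.\<close>

lemma smallo_power_Suc_if_deriv_smallo:
  fixes F F' :: "real \<Rightarrow> real"
  assumes deriv: "\<forall>\<^sub>F e in nhds 0. (F has_real_derivative F' e) (at e)"
    and "F 0 = 0"
    and small: "F' \<in> o[nhds 0](\<lambda>e. e ^ k)"
  shows "F \<in> o[nhds 0](\<lambda>e. e ^ Suc k)"
proof (rule landau_o.smallI)
  fix c :: real assume "c > 0"
  from landau_o.smallD[OF small this] deriv
  have "\<forall>\<^sub>F e in nhds 0. norm (F' e) \<le> c * norm (e ^ k) \<and> (F has_real_derivative F' e) (at e)"
    by (rule eventually_conj)
  then obtain d where "d > 0"
    and d: "\<And>e::real. \<bar>e\<bar> < d \<Longrightarrow> norm (F' e) \<le> c * norm (e ^ k) \<and> (F has_real_derivative F' e) (at e)"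
    by (auto simp: eventually_nhds_metric)
  have "norm (F e) \<le> c * norm (e ^ Suc k)" if e: "\<bar>e\<bar> < d" for e
  proof -
    have "norm (F e - F 0) \<le> c * norm (e ^ k) * norm (e - 0)"
    proof (rule field_differentiable_bound[of "cball 0 \<bar>e\<bar>"])
      fix x :: real assume "x \<in> cball 0 \<bar>e\<bar>"
      then have x: "\<bar>x\<bar> \<le> \<bar>e\<bar>" by simp
      with e have x': "\<bar>x\<bar> < d" by simp
      show "(F has_field_derivative F' x) (at x within cball 0 \<bar>e\<bar>)"
        using d[OF x'] by (blast intro: has_field_derivative_at_within)
      have "norm (F' x) \<le> c * \<bar>x\<bar> ^ k" using d[OF x'] by (simp add: power_abs)
      also have "\<dots> \<le> c * \<bar>e\<bar> ^ k"
        using \<open>c > 0\<close> x by (intro mult_left_mono power_mono) auto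
      finally show "norm (F' x) \<le> c * norm (e ^ k)" by (simp add: power_abs)
    qed auto
    with \<open>F 0 = 0\<close> show ?thesis by (simp add: abs_mult power_abs mult_ac)
  qed
  then show "\<forall>\<^sub>F e in nhds 0. norm (F e) \<le> c * norm (e ^ Suc k)"
    using \<open>d > 0\<close> unfolding eventually_nhds_metric by (auto simp: dist_real_def)
qed

section \<open>Taylor expansion with Peano remainder\<close>

definition taylor_poly :: "nat \<Rightarrow> (real \<Rightarrow> real) \<Rightarrow> real \<Rightarrow> real poly" where
  "taylor_poly k g p = (\<Sum>i\<le>k. monom ((deriv ^^ i) g p / fact i) i)"

lemma coeff_taylor_poly:
  "coeff (taylor_poly k g p) i = (if i \<le> k then (deriv ^^ i) g p / fact i else 0)"
  by (simp add: taylor_poly_def coeff_sum sum.delta)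

text \<open>The indeterminate stands for the displacement from \<open>p\<close>. Differentiation
  brings down the factor \<open>i + 1\<close>, which cancels against the factorial and shifts the
  derivatives of \<open>g\<close> by one.\<close>

lemma pderiv_taylor_poly: "pderiv (taylor_poly (Suc k) g p) = taylor_poly k (deriv g) p"
proof (rule poly_eqI)
  fix i
  have "(deriv ^^ i) (deriv g) = (deriv ^^ Suc i) g"
    by (simp add: funpow_swap1)
  then show "coeff (pderiv (taylor_poly (Suc k) g p)) i = coeff (taylor_poly k (deriv g) p) i"
    by (simp add: coeff_pderiv coeff_taylor_poly del: funpow.simps of_nat_Suc)
qed

lemma poly_taylor_poly_0: "poly (taylor_poly k g p) 0 = g p"
  by (simp add: poly_0_coeff_0 coeff_taylor_poly)

lemma times_differentiable_at_deriv:
  assumes "times_differentiable_at (Suc k) g p"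
  shows "times_differentiable_at k (deriv g) p"
  using assms unfolding times_differentiable_at_def
  by (metis Suc_less_eq comp_apply funpow_Suc_right)

text \<open>Induction on the order, for all \<open>g\<close> at once: the derivative of the
  remainder of \<open>g\<close> is the remainder of \<open>deriv g\<close>, so the bound for
  \<open>deriv g\<close> integrates to one with one more power. The top derivative is used only at
  \<open>p\<close>, in the base case, which is the definition of the derivative.\<close>

lemma taylor_smallo:
  assumes "times_differentiable_at (Suc k) g p"
  shows "(\<lambda>e. g (p + e) - poly (taylor_poly (Suc k) g p) e) \<in> o[nhds 0](\<lambda>e. e ^ Suc k)"
  using assms
proof (induction k arbitrary: g)
  case 0
  then have "g differentiable (at p)" by (simp add: times_differentiable_at_def)
  then have "(g has_real_derivative deriv g p) (at p)"
    by (simp add: DERIV_deriv_iff_real_differentiable)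
  then have lim: "((\<lambda>e. (g (p + e) - g p) / e) \<longlongrightarrow> deriv g p) (at 0)"
    by (simp add: DERIV_def)
  have "(\<lambda>e. g (p + e) - g p - deriv g p * e) \<in> o[nhds 0](\<lambda>e. e)"
  proof (rule landau_o.smallI)
    fix c :: real assume "c > 0"
    with lim have "\<forall>\<^sub>F e in at 0. dist ((g (p + e) - g p) / e) (deriv g p) < c"
      by (rule tendstoD)
    then have "\<forall>\<^sub>F e in at 0. norm (g (p + e) - g p - deriv g p * e) \<le> c * norm e"
      unfolding eventually_at_filter
    proof eventually_elim
      case (elim e)
      show ?case
      proof (intro impI)
        assume "e \<noteq> 0"
        then have "\<bar>(g (p + e) - g p - deriv g p * e) / e\<bar> < c"
          using elim by (simp add: dist_real_def diff_divide_distrib)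
        then show "norm (g (p + e) - g p - deriv g p * e) \<le> c * norm e"
          using \<open>e \<noteq> 0\<close> by (simp add: abs_divide divide_simps)
      qed
    qed
    \<comment> \<open>Both sides vanish at \<open>e = 0\<close>, so the punctured neighbourhood can
      be filled in.\<close>
    then show "\<forall>\<^sub>F e in nhds 0. norm (g (p + e) - g p - deriv g p * e) \<le> c * norm e"
      by (simp add: eventually_nhds_conv_at)
  qed
  moreover have "poly (taylor_poly (Suc 0) g p) e = g p + deriv g p * e" for e
    by (simp add: taylor_poly_def poly_monom)
  ultimately show ?case by (simp add: algebra_simps)
next
  case (Suc k)
  let ?P = "taylor_poly (Suc (Suc k)) g p"
  \<comment> \<open>The order is at least two here, so \<open>j = 0\<close> falls under the
    neighbourhood clause of \<open>times_differentiable_at\<close>.\<close>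
  have "\<forall>\<^sub>F x in nhds p. g differentiable (at x)"
    using Suc.prems unfolding times_differentiable_at_def
    by (metis Suc_less_eq funpow_0 zero_less_Suc)
  moreover have "filterlim (\<lambda>e. p + e) (nhds p) (nhds 0)"
    by (rule tendsto_eq_intros filterlim_ident | simp)+
  ultimately have "\<forall>\<^sub>F e in nhds 0. g differentiable (at (p + e))"
    by (rule eventually_compose_filterlim)
  then have "\<forall>\<^sub>F e in nhds 0. ((\<lambda>e. g (p + e) - poly ?P e) has_real_derivative
      deriv g (p + e) - poly (taylor_poly (Suc k) (deriv g) p) e) (at e)"
  proof eventually_elim
    case (elim e)
    then have "(g has_real_derivative deriv g (p + e)) (at (p + e))"
      by (simp add: DERIV_deriv_iff_real_differentiable)
    then have "((\<lambda>e. g (p + e)) has_real_derivative deriv g (p + e)) (at e)"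
      by (simp add: DERIV_shift add.commute)
    then show ?case
      unfolding pderiv_taylor_poly[symmetric] by (intro derivative_intros poly_DERIV)
  qed
  then show ?case
    by (rule smallo_power_Suc_if_deriv_smallo)
       (simp_all add: poly_taylor_poly_0 Suc.IH[OF times_differentiable_at_deriv[OF Suc.prems]]
         del: power_Suc)
qed

lemma times_differentiable_at_if_continuously_differentiable_near:
  assumes "continuously_differentiable_near k g p"
  shows "times_differentiable_at k g p"
proof -
  obtain S where "open S" "p \<in> S" "\<And>j x. j < k \<Longrightarrow> x \<in> S \<Longrightarrow> (deriv ^^ j) g differentiable (at x)"
    using assms by (auto simp: continuously_differentiable_near_def)
  then show ?thesis
    unfolding times_differentiable_at_def eventually_nhds by (metis Suc_lessD)
qed

section \<open>Arithmetic of truncated power series, modulo \<open>O(e ^ n)\<close>\<close>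

definition poly_approx :: "nat \<Rightarrow> (real \<Rightarrow> real) \<Rightarrow> real poly \<Rightarrow> bool" where
  "poly_approx n F p \<longleftrightarrow> (\<lambda>e. F e - poly p e) \<in> O[nhds 0](\<lambda>e. e ^ n)"

lemma poly_approx_poly: "poly_approx n (poly p) p"
  by (simp add: poly_approx_def)

lemma poly_approx_const: "poly_approx n (\<lambda>_. c) [:c:]"
  by (simp add: poly_approx_def)

lemma poly_approx_add:
  assumes "poly_approx n F p" "poly_approx n H q"
  shows "poly_approx n (\<lambda>e. F e + H e) (p + q)"
  using sum_in_bigo(1)[OF assms[unfolded poly_approx_def]]
  by (simp add: poly_approx_def algebra_simps)

lemma poly_approx_diff:
  assumes "poly_approx n F p" "poly_approx n H q"
  shows "poly_approx n (\<lambda>e. F e - H e) (p - q)"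
  using sum_in_bigo(2)[OF assms[unfolded poly_approx_def]]
  by (simp add: poly_approx_def algebra_simps)

lemma poly_bigo_1: "poly p \<in> O[nhds (x::real)](\<lambda>_. 1)"
  by (rule isCont_imp_bigo_1) simp

lemma poly_approx_bigo_1:
  assumes "poly_approx n F p"
  shows "F \<in> O[nhds 0](\<lambda>_. 1)"
proof -
  have "(\<lambda>e. F e - poly p e) \<in> O[nhds 0](\<lambda>e. 1)"
    using assms bigo_nhds_0_power_mono[of 0 n] unfolding poly_approx_def
    by (auto intro: landau_o.big_trans)
  from sum_in_bigo(1)[OF this poly_bigo_1[of p]] show ?thesis by simp
qed

text \<open>The error of the product splits as \<open>F * (H - q) + (F - p) * q\<close>, where
  \<open>F\<close> and \<open>q\<close> are bounded near 0.\<close>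

lemma poly_approx_mult:
  assumes F: "poly_approx n F p" and H: "poly_approx n H q"
  shows "poly_approx n (\<lambda>e. F e * H e) (p * q)"
proof -
  have "(\<lambda>e. F e * (H e - poly q e) + (F e - poly p e) * poly q e) \<in> O[nhds 0](\<lambda>e. e ^ n)"
    using landau_o.big.mult[OF poly_approx_bigo_1[OF F] H[unfolded poly_approx_def]]
      landau_o.big.mult[OF F[unfolded poly_approx_def] poly_bigo_1[of q]]
    by (intro sum_in_bigo) simp_all
  then show ?thesis by (simp add: poly_approx_def algebra_simps)
qed

lemma poly_bigo_power:
  assumes "\<forall>i<n. coeff p i = 0"
  shows "poly p \<in> O[nhds (0::real)](\<lambda>e. e ^ n)"
proof -
  have "monom 1 n dvd p"
    using assms by (simp add: monom_1_dvd_iff')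
  then obtain r where "p = monom 1 n * r" ..
  then have "poly p = (\<lambda>e. e ^ n * poly r e)" by (simp add: fun_eq_iff poly_monom)
  moreover have "(\<lambda>e. e ^ n * poly r e) \<in> O[nhds 0](\<lambda>e. e ^ n * 1)"
    by (intro landau_o.big.mult landau_o.big_refl poly_bigo_1)
  ultimately show ?thesis by simp
qed

text \<open>Terms of degree \<open>n\<close> and above are absorbed by the error. Polynomials
  obtained by exact multiplication or composition are thereby cut down to short explicit
  ones.\<close>

lemma poly_approx_cong_coeff:
  assumes "poly_approx n F p" and "\<forall>i<n. coeff p i = coeff q i"
  shows "poly_approx n F q"
  using sum_in_bigo(1)[OF assms(1)[unfolded poly_approx_def] poly_bigo_power[of n "p - q"]] assms(2)
  by (simp add: poly_approx_def)

lemma poly_approx_bigo: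
  assumes "poly_approx n F p" and "\<forall>i<m. coeff p i = 0" and "m \<le> n"
  shows "F \<in> O[nhds 0](\<lambda>e. e ^ m)"
proof -
  have "(\<lambda>e. F e - poly p e) \<in> O[nhds 0](\<lambda>e. e ^ m)"
    using assms(1) bigo_nhds_0_power_mono[OF assms(3)] unfolding poly_approx_def
    by (rule landau_o.big_trans)
  from sum_in_bigo(1)[OF this poly_bigo_power[OF assms(2)]] show ?thesis by simp
qed

lemma poly_approx_tendsto:
  assumes "poly_approx n F p" and "n > 0"
  shows "(F \<longlongrightarrow> coeff p 0) (nhds 0)"
proof -
  have "(\<lambda>e. F e - poly p e) \<in> O[nhds 0](\<lambda>e. e)"
    using poly_approx_bigo[OF poly_approx_diff[OF assms(1) poly_approx_poly[of n p]], of 1] assms(2)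
    by simp
  from bigo_id_imp_tendsto_0[OF this] have "((\<lambda>e. F e - poly p e) \<longlongrightarrow> 0) (nhds 0)" .
  moreover have "(poly p \<longlongrightarrow> poly p 0) (nhds 0)"
    using poly_isCont[of 0 p] by (simp add: isCont_def tendsto_at_iff_tendsto_nhds)
  ultimately have "((\<lambda>e. F e - poly p e + poly p e) \<longlongrightarrow> 0 + poly p 0) (nhds 0)"
    by (rule tendsto_add)
  then show ?thesis by (simp add: poly_0_coeff_0)
qed

text \<open>The quotient \<open>r\<close> is supplied, not computed, and checked by multiplying
  back. The error is \<open>(F - r * H) / H\<close>; its numerator is \<open>O(e ^ n)\<close>, and
  \<open>1 / H\<close> is bounded because \<open>H\<close> has a nonzero limit.\<close>

lemma poly_approx_divide:
  assumes F: "poly_approx n F p" and H: "poly_approx n H q"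
    and "n > 0" and q0: "coeff q 0 \<noteq> 0"
    and coeff: "\<forall>i<n. coeff p i = coeff (r * q) i"
  shows "poly_approx n (\<lambda>e. F e / H e) r"
proof -
  have lim: "(H \<longlongrightarrow> coeff q 0) (nhds 0)"
    using H \<open>n > 0\<close> by (rule poly_approx_tendsto)
  have "((\<lambda>e. inverse (H e) / 1) \<longlongrightarrow> inverse (coeff q 0)) (nhds 0)"
    using tendsto_inverse[OF lim q0] by simp
  then have inv: "(\<lambda>e. inverse (H e)) \<in> O[nhds 0](\<lambda>_. 1)"
    by (rule bigoI_tendsto) simp
  have "poly_approx n (\<lambda>e. F e - poly r e * H e) (p - r * q)"
    by (intro poly_approx_diff poly_approx_mult poly_approx_poly F H)
  then have "(\<lambda>e. F e - poly r e * H e) \<in> O[nhds 0](\<lambda>e. e ^ n)"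
    using coeff by (rule_tac poly_approx_bigo[of n _ "p - r * q"]) auto
  from landau_o.big.mult[OF this inv]
  have *: "(\<lambda>e. (F e - poly r e * H e) * inverse (H e)) \<in> O[nhds 0](\<lambda>e. e ^ n)" by simp
  have "\<forall>\<^sub>F e in nhds 0. H e \<noteq> 0"
    using lim q0 by (rule tendsto_imp_eventually_ne)
  then have "\<forall>\<^sub>F e in nhds 0. (F e - poly r e * H e) * inverse (H e) = F e / H e - poly r e"
    by eventually_elim (simp add: field_simps)
  from landau_o.big.in_cong[OF this] * show ?thesis by (simp add: poly_approx_def)
qed

text \<open>Horner's scheme: each \<open>pCons\<close> costs one product and one sum.\<close>

lemma poly_approx_poly_comp:
  assumes "poly_approx n F p"
  shows "poly_approx n (\<lambda>e. poly g (F e)) (pcompose g p)"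
proof (induction g)
  case 0
  show ?case using poly_approx_const[of n 0] by simp
next
  case (pCons a g)
  then show ?case
    using poly_approx_add[OF poly_approx_const poly_approx_mult[OF assms]]
    by (simp add: pcompose_pCons)
qed

text \<open>The vanishing constant term gives \<open>F = O(e)\<close>. Hence \<open>F\<close> tends
  to 0, where the expansion of \<open>H\<close> applies, and the error \<open>O(F ^ n)\<close> of
  that expansion is \<open>O(e ^ n)\<close>.\<close>

lemma poly_approx_comp:
  assumes F: "poly_approx n F p" and H: "poly_approx n H g"
    and "n > 0" and "coeff p 0 = 0"
  shows "poly_approx n (\<lambda>e. H (F e)) (pcompose g p)"
proof -
  have Fe: "F \<in> O[nhds 0](\<lambda>e. e)"
    using poly_approx_bigo[OF F, of 1] assms(3,4) by simp
  have "(\<lambda>e. H (F e) - poly g (F e)) \<in> O[nhds 0](\<lambda>e. F e ^ n)"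
    using landau_o.big.compose[OF H[unfolded poly_approx_def] bigo_id_imp_tendsto_0[OF Fe]] .
  also have "(\<lambda>e. F e ^ n) \<in> O[nhds 0](\<lambda>e. e ^ n)"
    using Fe by (rule landau_o.big_power)
  finally have "(\<lambda>e. H (F e) - poly g (F e)) \<in> O[nhds 0](\<lambda>e. e ^ n)" .
  from sum_in_bigo(1)[OF this poly_approx_poly_comp[OF F, of g, unfolded poly_approx_def]]
  show ?thesis by (simp add: poly_approx_def)
qed

lemma poly_approx_divide_X:
  assumes F: "poly_approx (Suc n) F (pCons 0 p)"
  obtains \<phi> where "poly_approx n \<phi> p" and "\<And>e. F e = e * \<phi> e"
proof
  \<comment> \<open>The value at 0 must be the limit \<open>coeff p 0\<close>: the estimate includes
    \<open>e = 0\<close>, where the total division would return 0.\<close>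
  let ?\<phi> = "\<lambda>e. if e = 0 then coeff p 0 else F e / e"
  obtain c where c: "\<forall>\<^sub>F e in nhds 0. norm (F e - e * poly p e) \<le> c * norm (e ^ Suc n)"
    using F unfolding poly_approx_def by (auto elim: landau_o.bigE)
  \<comment> \<open>A property that holds throughout a neighbourhood of 0 holds at 0, where the
    right-hand side of the bound is 0.\<close>
  have "F 0 = 0"
    using eventually_nhds_x_imp_x[OF c] by simp
  then show "F e = e * ?\<phi> e" for e by simp
  have "\<forall>\<^sub>F e in nhds 0. norm (?\<phi> e - poly p e) \<le> \<bar>c\<bar> * norm (e ^ n)"
    using c
  proof eventually_elim
    case (elim e)
    show ?case
    proof (cases "e = 0")
      case False
      then have "\<bar>e\<bar> * \<bar>F e / e - poly p e\<bar> = \<bar>F e - e * poly p e\<bar>"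
        by (simp flip: abs_mult add: algebra_simps)
      also have "\<dots> \<le> \<bar>c\<bar> * \<bar>e ^ Suc n\<bar>"
        using elim mult_right_mono[OF abs_ge_self[of c] abs_ge_zero[of "e ^ Suc n"]]
        by (simp del: power_Suc)
      finally have "\<bar>e\<bar> * \<bar>F e / e - poly p e\<bar> \<le> \<bar>e\<bar> * (\<bar>c\<bar> * \<bar>e ^ n\<bar>)"
        by (simp add: abs_mult mult_ac)
      with False show ?thesis by simp
    qed (simp add: poly_0_coeff_0)
  qed
  then show "poly_approx n ?\<phi> p"
    unfolding poly_approx_def by (rule bigoI)
qed

text \<open>The term of degree \<open>Suc k\<close> is itself \<open>O(e ^ Suc k)\<close>, so it is
  dropped from the Taylor polynomial.\<close>

lemma poly_approx_taylor_poly: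
  assumes "times_differentiable_at (Suc k) g p"
  shows "poly_approx (Suc k) (\<lambda>e. g (p + e)) (taylor_poly k g p)"
proof (rule poly_approx_cong_coeff)
  show "poly_approx (Suc k) (\<lambda>e. g (p + e)) (taylor_poly (Suc k) g p)"
    unfolding poly_approx_def using taylor_smallo[OF assms] by (rule landau_o.small_imp_big)
qed (simp add: coeff_taylor_poly)

section \<open>Expansion of one step of the method\<close>

lemma all_less_4_iff: "(\<forall>i<4. P i) \<longleftrightarrow> P 0 \<and> P (Suc 0) \<and> P (Suc (Suc 0)) \<and> P (Suc (Suc (Suc (0::nat))))"
  by (auto simp: numeral_eq_Suc less_Suc_eq)

text \<open>Here \<open>w\<close> is \<open>t - 1\<close> and \<open>B\<close> is
  \<open>- (3 - t) * v / 2\<close>; both depend on \<open>f\<close> alone. The weight enters only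
  through its distance from the cubic that carries the prescribed values \<open>1\<close>,
  \<open>- 1/4\<close>, \<open>2 / 2!\<close> and a free third derivative \<open>k\<close>, so
  different smoothness assumptions on \<open>G\<close> can be inserted afterwards.\<close>

lemma method_step_expansion:
  fixes f :: "real \<Rightarrow> real" and \<alpha> :: real
  assumes diff: "times_differentiable_at 5 f \<alpha>" and root: "simple_root f \<alpha>"
  defines "c \<equiv> error_coeff f \<alpha>"
  obtains w B where "w \<in> O[nhds 0](\<lambda>e. e)" "B \<in> O[nhds 0](\<lambda>_. 1)"
    "\<And>G k. (\<lambda>e. method_step f G (2/3) (\<alpha> + e) - \<alpha>
        - (- c 2 * c 3 + c 4 / 9 + 1/81 * (309 + 32 * k) * (c 2) ^ 3) * e ^ 4
        - e * B e * (G (1 + w e) - poly [:1, - 1/4, 1, k / 6:] (w e))) \<in> O[nhds 0](\<lambda>e. e ^ 5)"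
proof -
  define d where "d = deriv f \<alpha>"
  have f0: "f \<alpha> = 0" and d0: "d \<noteq> 0"
    using root by (auto simp: simple_root_def d_def)
  have D: "deriv f \<alpha> = d" "deriv (deriv f) \<alpha> = 2 * d * c 2"
      "deriv (deriv (deriv f)) \<alpha> = 6 * d * c 3"
      "deriv (deriv (deriv (deriv f))) \<alpha> = 24 * d * c 4"
    using d0 by (simp_all add: c_def error_coeff_def d_def numeral_eq_Suc)
  \<comment> \<open>One order more than the target: dividing by \<open>e\<close> below leaves
    \<open>O(e ^ 4)\<close>. The leading 0 is the root condition.\<close>
  have "poly_approx (Suc 4) (\<lambda>e. f (\<alpha> + e)) (taylor_poly 4 f \<alpha>)"
    using diff by (intro poly_approx_taylor_poly) simp
  then have "poly_approx (Suc 4) (\<lambda>e. f (\<alpha> + e)) (pCons 0 [:d, d * c 2, d * c 3, d * c 4:])"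
    by (rule poly_approx_cong_coeff)
       (simp add: All_less_Suc2 coeff_taylor_poly f0 D fact_numeral numeral_eq_Suc)
  then obtain \<phi> where \<phi>: "poly_approx 4 \<phi> [:d, d * c 2, d * c 3, d * c 4:]"
    and f_eq: "\<And>e. f (\<alpha> + e) = e * \<phi> e"
    using poly_approx_divide_X by blast
  define \<psi> where "\<psi> e = deriv f (\<alpha> + e)" for e
  have "poly_approx (Suc 3) (\<lambda>e. deriv f (\<alpha> + e)) (taylor_poly 3 (deriv f) \<alpha>)"
    using diff by (intro poly_approx_taylor_poly times_differentiable_at_deriv) simp
  then have \<psi>: "poly_approx 4 \<psi> [:d, 2 * d * c 2, 3 * d * c 3, 4 * d * c 4:]" (is "poly_approx _ _ ?\<psi>")
    unfolding \<psi>_def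
    by (rule_tac poly_approx_cong_coeff[of 4 _ "taylor_poly 3 (deriv f) \<alpha>"])
       (simp_all add: All_less_Suc2 coeff_taylor_poly D fact_numeral numeral_eq_Suc)
  define v where "v e = \<phi> e / \<psi> e" for e
  \<comment> \<open>The coefficients solve \<open>v * \<psi> = \<phi>\<close> degree by degree; the
    common factor \<open>d\<close> cancels.\<close>
  have v: "poly_approx 4 v [:1, - c 2, 2 * c 2 ^ 2 - 2 * c 3,
      - 4 * c 2 ^ 3 + 7 * c 2 * c 3 - 3 * c 4:]" (is "poly_approx _ _ ?v")
    unfolding v_def using d0
    by (intro poly_approx_divide[OF \<phi> \<psi>])
       (simp_all add: all_less_4_iff algebra_simps power2_eq_square power3_eq_cube)
  \<comment> \<open>The error \<open>y - \<alpha>\<close> of the inner point; its linear coefficient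
    is \<open>1 - 2/3\<close>.\<close>
  define z where "z e = e - 2/3 * (e * v e)" for e
  have id: "poly_approx n (\<lambda>e. e) [:0, 1:]" for n
    by (simp add: poly_approx_def)
  have "poly_approx 4 z ([:0, 1:] - [:2/3:] * ([:0, 1:] * ?v))"
    unfolding z_def by (intro poly_approx_diff poly_approx_mult poly_approx_const id v)
  then have z: "poly_approx 4 z [:0, 1/3, 2/3 * c 2, 4/3 * (c 3 - c 2 ^ 2):]" (is "poly_approx _ _ ?z")
    by (rule poly_approx_cong_coeff) (simp add: all_less_4_iff algebra_simps)
  \<comment> \<open>This is the derivative of \<open>f\<close> at \<open>y\<close>. Composition is
    legitimate because \<open>z\<close> has no constant term.\<close>
  have "poly_approx 4 (\<lambda>e. \<psi> (z e)) (pcompose ?\<psi> ?z)"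
    by (rule poly_approx_comp[OF z \<psi>]) simp_all
  then have \<psi>z: "poly_approx 4 (\<lambda>e. \<psi> (z e)) [:d, d * (2/3 * c 2), d * (4/3 * c 2 ^ 2 + 1/3 * c 3),
      d * (- 8/3 * c 2 ^ 3 + 4 * c 2 * c 3 + 4/27 * c 4):]"
    by (rule poly_approx_cong_coeff)
       (simp add: all_less_4_iff pcompose_pCons algebra_simps power2_eq_square power3_eq_cube)
  define t where "t e = \<psi> (z e) / \<psi> e" for e
  have t: "poly_approx 4 t [:1, - 4/3 * c 2, 4 * c 2 ^ 2 - 8/3 * c 3,
      - 32/3 * c 2 ^ 3 + 40/3 * c 2 * c 3 - 104/27 * c 4:]" (is "poly_approx _ _ ?t")
    unfolding t_def using d0
    by (intro poly_approx_divide[OF \<psi>z \<psi>])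
       (simp_all add: all_less_4_iff field_simps power2_eq_square power3_eq_cube)
  define w where "w e = t e - 1" for e
  have "poly_approx 4 w (?t - [:1:])"
    unfolding w_def by (intro poly_approx_diff t poly_approx_const)
  then have w: "poly_approx 4 w [:0, - 4/3 * c 2, 4 * c 2 ^ 2 - 8/3 * c 3,
      - 32/3 * c 2 ^ 3 + 40/3 * c 2 * c 3 - 104/27 * c 4:]" (is "poly_approx _ _ ?w")
    by simp
  \<comment> \<open>Chosen so that the new error is \<open>e * (1 + B e * G (t e))\<close>.\<close>
  define B where "B e = - 1/2 * ((3 - t e) * v e)" for e
  have "poly_approx 4 B ([:- 1/2:] * (([:3:] - ?t) * ?v))"
    unfolding B_def by (intro poly_approx_diff poly_approx_mult poly_approx_const t v)
  then have B: "poly_approx 4 B [:- 1, 1/3 * c 2, 2/3 * c 2 ^ 2 + 2/3 * c 3,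
      - 14/3 * c 2 ^ 3 + 7/3 * c 2 * c 3 + 29/27 * c 4:]" (is "poly_approx _ _ ?B")
    by (rule poly_approx_cong_coeff)
       (simp add: all_less_4_iff field_simps power2_eq_square power3_eq_cube)
  show thesis
  proof (rule that)
    show "w \<in> O[nhds 0](\<lambda>e. e)"
      using poly_approx_bigo[OF w, of 1] by simp
    show "B \<in> O[nhds 0](\<lambda>_. 1)"
      using B by (rule poly_approx_bigo_1)
    fix G :: "real \<Rightarrow> real" and k :: real
    let ?g = "[:1, - 1/4, 1, k / 6:]"
    let ?C = "- c 2 * c 3 + c 4 / 9 + 1/81 * (309 + 32 * k) * (c 2) ^ 3"
    have "poly_approx 4 (\<lambda>e. poly ?g (w e)) (pcompose ?g ?w)"
      using w by (rule poly_approx_poly_comp)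
    then have g: "poly_approx 4 (\<lambda>e. poly ?g (w e)) [:1, 1/3 * c 2, 7/9 * c 2 ^ 2 + 2/3 * c 3,
        - 8 * c 2 ^ 3 + 34/9 * c 2 * c 3 + 26/27 * c 4 - 32/81 * c 2 ^ 3 * k:]"
      (is "poly_approx _ _ ?G")
      by (rule poly_approx_cong_coeff)
         (simp add: all_less_4_iff pcompose_pCons field_simps power2_eq_square power3_eq_cube)
    have "poly_approx 4 (\<lambda>e. 1 + B e * poly ?g (w e)) ([:1:] + ?B * ?G)"
      by (intro poly_approx_add poly_approx_mult poly_approx_const B g)
    \<comment> \<open>The cancellation behind order four. In degree one, \<open>v\<close>
      contributes \<open>- c 2\<close>, \<open>(3 - t) / 2\<close> contributes
      \<open>2/3 * c 2\<close> and the weight \<open>1/3 * c 2\<close>. In degree two, the quadratic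
      coefficient 1 of the weight balances \<open>c 2 ^ 2\<close>, and the \<open>c 3\<close> terms
      cancel.\<close>
    then have "poly_approx 4 (\<lambda>e. 1 + B e * poly ?g (w e)) [:0, 0, 0, ?C:]"
      by (rule poly_approx_cong_coeff)
         (simp add: all_less_4_iff field_simps power2_eq_square power3_eq_cube)
    from landau_o.big.mult[OF landau_o.big_refl[of "\<lambda>e. e"] this[unfolded poly_approx_def]]
    have "(\<lambda>e. e * (1 + B e * poly ?g (w e)) - ?C * e ^ 4) \<in> O[nhds 0](\<lambda>e. e ^ 5)"
      by (simp add: algebra_simps power_numeral_reduce)
    \<comment> \<open>An identity for every \<open>e\<close>, so all error comes from the
      expansions.\<close>
    moreover have "method_step f G (2/3) (\<alpha> + e) - \<alpha> = e + e * B e * G (1 + w e)" for e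
    proof -
      have "f (\<alpha> + e) / deriv f (\<alpha> + e) = e * v e"
        by (simp add: f_eq v_def \<psi>_def)
      moreover have "\<alpha> + e - 2/3 * (e * v e) = \<alpha> + z e"
        by (simp add: z_def)
      moreover have "deriv f (\<alpha> + z e) / deriv f (\<alpha> + e) = t e"
        by (simp add: t_def \<psi>_def)
      ultimately show ?thesis
        by (simp only: method_step_def Let_def) (simp add: B_def w_def algebra_simps)
    qed
    ultimately show "(\<lambda>e. method_step f G (2/3) (\<alpha> + e) - \<alpha> - ?C * e ^ 4
        - e * B e * (G (1 + w e) - poly ?g (w e))) \<in> O[nhds 0](\<lambda>e. e ^ 5)"
      by (simp add: algebra_simps)
  qed
qed

text \<open>Only the Taylor remainder of \<open>G\<close> at \<open>1 + w e\<close> is left to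
  bound. Since \<open>w = O(e)\<close>, it is \<open>o(e ^ 3)\<close> or \<open>O(e ^ 4)\<close>
  according to the smoothness of \<open>G\<close>, and the prefactor \<open>e * B e\<close> adds one
  power.\<close>

lemma method_step_error:
  fixes f G :: "real \<Rightarrow> real" and \<alpha> :: real
  assumes f: "times_differentiable_at 5 f \<alpha>" "simple_root f \<alpha>"
    and G: "times_differentiable_at 3 G 1"
    and G1: "G 1 = 1" "deriv G 1 = - 1/4" "(deriv ^^ 2) G 1 = 2"
  defines "c \<equiv> error_coeff f \<alpha>"
  defines "C \<equiv> - c 2 * c 3 + c 4 / 9 + 1/81 * (309 + 32 * (deriv ^^ 3) G 1) * (c 2) ^ 3"
  defines "R \<equiv> \<lambda>e. method_step f G (2/3) (\<alpha> + e) - \<alpha> - C * e ^ 4"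
  shows "R \<in> o[nhds 0](\<lambda>e. e ^ 4)"
    and "times_differentiable_at 4 G 1 \<Longrightarrow> R \<in> O[nhds 0](\<lambda>e. e ^ 5)"
proof -
  obtain w B where w: "w \<in> O[nhds 0](\<lambda>e. e)" and B: "B \<in> O[nhds 0](\<lambda>_. 1)"
    and main: "\<And>G k. (\<lambda>e. method_step f G (2/3) (\<alpha> + e) - \<alpha>
        - (- c 2 * c 3 + c 4 / 9 + 1/81 * (309 + 32 * k) * (c 2) ^ 3) * e ^ 4
        - e * B e * (G (1 + w e) - poly [:1, - 1/4, 1, k / 6:] (w e))) \<in> O[nhds 0](\<lambda>e. e ^ 5)"
    unfolding c_def using method_step_expansion[OF f] by blast
  let ?g = "[:1, - 1/4, 1, (deriv ^^ 3) G 1 / 6:]"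
  let ?rem = "\<lambda>e. G (1 + w e) - poly ?g (w e)"
  have main: "(\<lambda>e. R e - e * B e * ?rem e) \<in> O[nhds 0](\<lambda>e. e ^ 5)"
    unfolding R_def C_def by (rule main)
  have taylor: "taylor_poly 3 G 1 = ?g"
    using G1 by (intro poly_eqI)
      (auto simp: coeff_taylor_poly coeff_pCons numeral_eq_Suc le_Suc_eq split: nat.splits)
  note w0 = bigo_id_imp_tendsto_0[OF w]
  have eB: "(\<lambda>e. e * B e) \<in> O[nhds 0](\<lambda>e. e)"
    using landau_o.big.mult[OF landau_o.big_refl[of "\<lambda>e. e"] B] by simp
  have "(\<lambda>e. G (1 + e) - poly ?g e) \<in> o[nhds 0](\<lambda>e. e ^ 3)"
    using taylor_smallo[of 2 G 1] G taylor by simp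
  from landau_o.small.compose[OF this w0]
  have "?rem \<in> o[nhds 0](\<lambda>e. w e ^ 3)" .
  also have "(\<lambda>e. w e ^ 3) \<in> O[nhds 0](\<lambda>e. e ^ 3)"
    using w by (rule landau_o.big_power)
  finally have "?rem \<in> o[nhds 0](\<lambda>e. e ^ 3)" .
  from landau_o.big_small_mult[OF eB this]
  have "(\<lambda>e. e * B e * ?rem e) \<in> o[nhds 0](\<lambda>e. e ^ 4)"
    by (simp add: power_numeral_reduce)
  \<comment> \<open>Needed to weaken the \<open>O(e ^ 5)\<close> error of the expansion to
    \<open>o(e ^ 4)\<close>.\<close>
  moreover have "(\<lambda>e::real. e ^ 5) \<in> o[nhds 0](\<lambda>e. e ^ 4)"
  proof -
    have "(\<lambda>e::real. e) \<in> o[nhds 0](\<lambda>_. 1)"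
      by (rule smalloI_tendsto) (simp_all add: filterlim_ident)
    from landau_o.small_big_mult[OF this landau_o.big_refl[of "\<lambda>e. e ^ 4"]]
    show ?thesis by (simp add: power_numeral_reduce)
  qed
  ultimately have "(\<lambda>e. R e - e * B e * ?rem e + e * B e * ?rem e) \<in> o[nhds 0](\<lambda>e. e ^ 4)"
    using landau_o.big_small_trans[OF main] by (intro sum_in_smallo(1))
  then show "R \<in> o[nhds 0](\<lambda>e. e ^ 4)" by simp
  assume "times_differentiable_at 4 G 1"
  then have "(\<lambda>e. G (1 + e) - poly ?g e) \<in> O[nhds 0](\<lambda>e. e ^ 4)"
    using poly_approx_taylor_poly[of 3 G 1] taylor by (simp add: poly_approx_def)
  from landau_o.big.compose[OF this w0]
  have "?rem \<in> O[nhds 0](\<lambda>e. w e ^ 4)" .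
  also have "(\<lambda>e. w e ^ 4) \<in> O[nhds 0](\<lambda>e. e ^ 4)"
    using w by (rule landau_o.big_power)
  finally have "?rem \<in> O[nhds 0](\<lambda>e. e ^ 4)" .
  from landau_o.big.mult[OF eB this]
  have "(\<lambda>e. e * B e * ?rem e) \<in> O[nhds 0](\<lambda>e. e ^ 5)"
    by (simp add: power_numeral_reduce)
  with main have "(\<lambda>e. R e - e * B e * ?rem e + e * B e * ?rem e) \<in> O[nhds 0](\<lambda>e. e ^ 5)"
    by (rule sum_in_bigo)
  then show "R \<in> O[nhds 0](\<lambda>e. e ^ 5)" by simp
qed

section \<open>From one step to sequences of iterates\<close>

lemma local_convergence_if_smallo:
  fixes T :: "real \<Rightarrow> real"
  assumes small: "(\<lambda>e. T (\<alpha> + e) - \<alpha>) \<in> o[nhds 0](\<lambda>e. e)"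
    and P: "\<forall>\<^sub>F y in nhds \<alpha>. P y"
  shows "\<exists>\<delta>>0. \<forall>x. (\<forall>n. x (Suc n) = T (x n)) \<and> \<bar>x 0 - \<alpha>\<bar> < \<delta> \<longrightarrow>
           (\<forall>n. P (x n)) \<and> x \<longlonglongrightarrow> \<alpha>"
proof -
  \<comment> \<open>A superlinear step contracts the error near the root; the factor 1/2 stands for
    any number strictly between 0 and 1.\<close>
  have "\<forall>\<^sub>F e in nhds 0. norm (T (\<alpha> + e) - \<alpha>) \<le> 1/2 * norm e"
    by (rule landau_o.smallD[OF small]) simp
  then obtain d1 where "d1 > 0"
    and d1: "\<And>e::real. \<bar>e\<bar> < d1 \<Longrightarrow> \<bar>T (\<alpha> + e) - \<alpha>\<bar> \<le> 1/2 * \<bar>e\<bar>"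
    by (auto simp: eventually_nhds_metric)
  obtain d2 where "d2 > 0" and d2: "\<And>y. \<bar>y - \<alpha>\<bar> < d2 \<Longrightarrow> P y"
    using P by (auto simp: eventually_nhds_metric dist_real_def)
  show ?thesis
  proof (intro exI[of _ "min d1 d2"] conjI allI impI; (elim conjE)?)
    show "min d1 d2 > 0" using \<open>d1 > 0\<close> \<open>d2 > 0\<close> by simp
    fix x :: "nat \<Rightarrow> real"
    assume x: "\<forall>n. x (Suc n) = T (x n)" and x0: "\<bar>x 0 - \<alpha>\<bar> < min d1 d2"
    \<comment> \<open>The bound at \<open>n\<close> keeps \<open>x n\<close> no farther from
      \<alpha> than \<open>x 0\<close>, hence inside the region of contraction for the next
      step.\<close>
    have bound: "\<bar>x n - \<alpha>\<bar> \<le> \<bar>x 0 - \<alpha>\<bar> * (1/2) ^ n" for n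
    proof (induction n)
      case (Suc n)
      have "\<bar>x 0 - \<alpha>\<bar> * (1/2) ^ n \<le> \<bar>x 0 - \<alpha>\<bar> * 1"
        by (intro mult_left_mono power_le_one) auto
      with Suc x0 have "\<bar>x n - \<alpha>\<bar> < d1" by simp
      from d1[OF this] Suc x show ?case by simp
    qed simp
    have "P (x n)" for n
    proof (rule d2)
      have "\<bar>x 0 - \<alpha>\<bar> * (1/2) ^ n \<le> \<bar>x 0 - \<alpha>\<bar> * 1"
        by (intro mult_left_mono power_le_one) auto
      with bound[of n] x0 show "\<bar>x n - \<alpha>\<bar> < d2" by simp
    qed
    then show "P (x n)" for n .
    have "(\<lambda>n. \<bar>x 0 - \<alpha>\<bar> * (1/2) ^ n) \<longlonglongrightarrow> \<bar>x 0 - \<alpha>\<bar> * 0"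
      by (intro tendsto_intros LIMSEQ_power_zero) simp
    then have "(\<lambda>n. x n - \<alpha>) \<longlonglongrightarrow> 0"
      by (intro Lim_null_comparison[of "\<lambda>n. x n - \<alpha>" "\<lambda>n. \<bar>x 0 - \<alpha>\<bar> * (1/2) ^ n"])
         (simp_all add: bound)
    then show "x \<longlonglongrightarrow> \<alpha>" by (rule LIM_zero_cancel)
  qed
qed

text \<open>Divide the error equation by \<open>(x n - \<alpha>) ^ m\<close>; as the errors are
  nonzero, the main term becomes exactly \<open>C\<close>.\<close>

lemma has_convergence_order_if_smallo:
  fixes x :: "nat \<Rightarrow> real"
  assumes "0 < m" "x \<longlonglongrightarrow> \<alpha>" "\<forall>n. x n \<noteq> \<alpha>" "C \<noteq> 0"
    and small: "(\<lambda>n. (x (Suc n) - \<alpha>) - C * (x n - \<alpha>) ^ m) \<in> o(\<lambda>n. (x n - \<alpha>) ^ m)"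
  shows "has_convergence_order x \<alpha> m C"
proof -
  have "(\<lambda>n. ((x (Suc n) - \<alpha>) - C * (x n - \<alpha>) ^ m) / (x n - \<alpha>) ^ m) \<longlonglongrightarrow> 0"
    using small by (rule smalloD_tendsto)
  then have "(\<lambda>n. (x (Suc n) - \<alpha>) / (x n - \<alpha>) ^ m - C) \<longlonglongrightarrow> 0"
    using assms(3) by (simp add: diff_divide_distrib)
  then have "(\<lambda>n. (x (Suc n) - \<alpha>) / (x n - \<alpha>) ^ m) \<longlonglongrightarrow> C"
    by (rule LIM_zero_cancel)
  with assms(1-4) show ?thesis by (simp add: has_convergence_order_def)
qed

text \<open>\<open>C\<close> can vanish for particular \<open>f\<close> and \<open>G\<close>, and a
  sequence can reach the root; the limit defining order four is therefore stated for nonzero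
  \<open>C\<close> and nonzero errors, while the error equation covers every convergent
  sequence.\<close>

theorem theorem3p1:
  fixes f G :: "real \<Rightarrow> real" and \<alpha> a :: real
  assumes "continuously_differentiable_near 5 f \<alpha>"
    and "simple_root f \<alpha>"
    and "a = 2/3"
    and "times_differentiable_at 3 G 1"
    and "G 1 = 1" and "deriv G 1 = - 1/4" and "(deriv ^^ 2) G 1 = 2"
  shows
    "let c = error_coeff f \<alpha>;
         C = - c 2 * c 3 + c 4 / 9 + 1/81 * (309 + 32 * (deriv ^^ 3) G 1) * (c 2) ^ 3
     in (\<exists>\<delta>>0. \<forall>x. method_sequence f G a x \<and> \<bar>x 0 - \<alpha>\<bar> < \<delta> \<longrightarrow>
            (\<forall>n. deriv f (x n) \<noteq> 0) \<and> x \<longlonglongrightarrow> \<alpha>) \<and>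
        (\<forall>x. method_sequence f G a x \<and> x \<longlonglongrightarrow> \<alpha> \<longrightarrow>
            (C \<noteq> 0 \<and> (\<forall>n. x n \<noteq> \<alpha>) \<longrightarrow> has_convergence_order x \<alpha> 4 C) \<and>
            (\<lambda>n. (x (Suc n) - \<alpha>) - C * (x n - \<alpha>) ^ 4) \<in> o(\<lambda>n. (x n - \<alpha>) ^ 4) \<and>
            (continuously_differentiable_near 4 G 1 \<longrightarrow>
              (\<lambda>n. (x (Suc n) - \<alpha>) - C * (x n - \<alpha>) ^ 4) \<in> O(\<lambda>n. (x n - \<alpha>) ^ 5)))"
proof -
  define c where "c = error_coeff f \<alpha>"
  define C where "C = - c 2 * c 3 + c 4 / 9 + 1/81 * (309 + 32 * (deriv ^^ 3) G 1) * (c 2) ^ 3"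
  define R where "R e = method_step f G (2/3) (\<alpha> + e) - \<alpha> - C * e ^ 4" for e
  have f: "times_differentiable_at 5 f \<alpha>"
    using assms(1) by (rule times_differentiable_at_if_continuously_differentiable_near)
  note R = method_step_error[OF f assms(2,4-7),
      folded c_def, folded C_def, folded R_def[abs_def]]
  \<comment> \<open>The sum is the full new error; being \<open>o(e)\<close>, it makes the step a
    local contraction.\<close>
  have "(\<lambda>e. R e + C * e ^ 4) \<in> o[nhds 0](\<lambda>e. e)"
  proof -
    have *: "(\<lambda>e::real. e ^ 4) \<in> o[nhds 0](\<lambda>e. e)"
    proof -
      have "((\<lambda>e::real. e ^ 3) \<longlongrightarrow> 0 ^ 3) (nhds 0)"
        by (intro tendsto_power filterlim_ident)
      then have "(\<lambda>e::real. e ^ 3) \<in> o[nhds 0](\<lambda>_. 1)"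
        by (intro smalloI_tendsto) simp_all
      from landau_o.small_big_mult[OF this landau_o.big_refl[of "\<lambda>e. e"]]
      show ?thesis by (simp add: power_numeral_reduce mult_ac)
    qed
    show ?thesis
      using landau_o.small_trans[OF R(1) *] * by (intro sum_in_smallo) simp_all
  qed
  then have small: "(\<lambda>e. method_step f G (2/3) (\<alpha> + e) - \<alpha>) \<in> o[nhds 0](\<lambda>e. e)"
    by (simp add: R_def)
  \<comment> \<open>Continuity keeps \<open>deriv f\<close> nonzero near the simple root, so the
    Newton quotients along the iterates are genuine.\<close>
  have "isCont (deriv f) \<alpha>"
  proof -
    have "\<forall>j<5. (deriv ^^ j) f differentiable (at \<alpha>)"
      using f by (simp add: times_differentiable_at_def)
    from this[rule_format, of 1] have "deriv f differentiable (at \<alpha>)" by simp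
    then show ?thesis
      by (simp add: differentiable_imp_continuous_within)
  qed
  then have "\<forall>\<^sub>F y in nhds \<alpha>. deriv f y \<noteq> 0"
    using assms(2) by (intro tendsto_imp_eventually_ne[where c = "deriv f \<alpha>"])
      (auto simp: isCont_def tendsto_at_iff_tendsto_nhds simple_root_def)
  from local_convergence_if_smallo[OF small this]
  have conv: "\<exists>\<delta>>0. \<forall>x. method_sequence f G a x \<and> \<bar>x 0 - \<alpha>\<bar> < \<delta> \<longrightarrow>
      (\<forall>n. deriv f (x n) \<noteq> 0) \<and> x \<longlonglongrightarrow> \<alpha>"
    by (simp add: method_sequence_def assms(3))
  have order: "(C \<noteq> 0 \<and> (\<forall>n. x n \<noteq> \<alpha>) \<longrightarrow> has_convergence_order x \<alpha> 4 C) \<and>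
      (\<lambda>n. (x (Suc n) - \<alpha>) - C * (x n - \<alpha>) ^ 4) \<in> o(\<lambda>n. (x n - \<alpha>) ^ 4) \<and>
      (continuously_differentiable_near 4 G 1 \<longrightarrow>
        (\<lambda>n. (x (Suc n) - \<alpha>) - C * (x n - \<alpha>) ^ 4) \<in> O(\<lambda>n. (x n - \<alpha>) ^ 5))"
    if x: "method_sequence f G a x" and lim: "x \<longlonglongrightarrow> \<alpha>" for x
  proof -
    have e: "filterlim (\<lambda>n. x n - \<alpha>) (nhds 0) sequentially"
      using lim by (rule LIM_zero)
    \<comment> \<open>Evaluated along the errors of the sequence, \<open>R\<close> is the remainder
      of the error equation, so its bounds transfer by composition.\<close>
    have R_eq: "R (x n - \<alpha>) = (x (Suc n) - \<alpha>) - C * (x n - \<alpha>) ^ 4" for n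
      using x by (simp add: R_def method_sequence_def assms(3))
    have small: "(\<lambda>n. (x (Suc n) - \<alpha>) - C * (x n - \<alpha>) ^ 4) \<in> o(\<lambda>n. (x n - \<alpha>) ^ 4)"
      using landau_o.small.compose[OF R(1) e] by (simp add: R_eq)
    moreover have "(\<lambda>n. (x (Suc n) - \<alpha>) - C * (x n - \<alpha>) ^ 4) \<in> O(\<lambda>n. (x n - \<alpha>) ^ 5)"
      if "continuously_differentiable_near 4 G 1"
      using landau_o.big.compose[OF R(2) e] that
      by (simp add: R_eq times_differentiable_at_if_continuously_differentiable_near)
    ultimately show ?thesis
      using has_convergence_order_if_smallo[OF _ lim _ _ small] by simp
  qed
  show ?thesis
    using conv order unfolding Let_def C_def c_def by blast
qed

end
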